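(* Let $\upsilon\ge1$ be an integer, $q>-1$ and $p$ real, $s\ge0$ an integer with $s<\frac{p-1}{2}$, $t\ne0$ real, and let $y$ be a real number and $a$ a complex number with $\operatorname{Re}(a)>0$ and $\left|\frac{y^{\upsilon}}{a^{\upsilon}}\right|<1$. Then the Laplace transform in $w$, evaluated at $a$, satisfies $$\mathcal L\left\{w^q\,{}_KN_{s;\upsilon}^{(p,q)}(t,yw)\right\}(a)=\frac{\Gamma(p-s)}{a^{q+1}\,\Gamma(p-2s)}\left(\frac{t(a^{\upsilon}-y^{\upsilon})}{a^{\upsilon}}\right)^{s}{}_1F_1\!\left[-s,\,p-2s;\,\frac{a^{\upsilon}}{t(a^{\upsilon}-y^{\upsilon})}\right].$$
   Context: $(a)_n$ is the Pochhammer symbol. The first set of finite bivariate biorthogonal N-Konhauser polynomials is $${}_KN_{s;\upsilon}^{(p,q)}(t,w)=\Gamma(p-s)\sum_{k=0}^{s}\sum_{m=0}^{s-k}\frac{(-s)_{k+m}\,t^{s-k}w^{\upsilon m}}{\Gamma(p-2s+k)\,\Gamma(q+1+\upsilon m)\,k!\,m!}.$$ The Laplace transform is $\mathcal L\{f\}(a)=\int_0^\infty e^{-aw}f(w)\,dw$, $\operatorname{Re}(a)>0$; ${}_1F_1[\alpha,c;x]=\sum_{k\ge0}\frac{(\alpha)_k}{(c)_k}\frac{x^k}{k!}$; $a^{q+1}$ is the principal power. *)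

theory Defs
  imports "HOL-Analysis.Analysis"
begin

definition konhauser_N :: "nat \<Rightarrow> nat \<Rightarrow> real \<Rightarrow> real \<Rightarrow> real \<Rightarrow> real \<Rightarrow> real" where
  "konhauser_N s \<upsilon> p q t w =
     Gamma (p - real s) *
     (\<Sum>k=0..s. \<Sum>m=0..s - k.
        pochhammer (- real s) (k + m) * t ^ (s - k) * w ^ (\<upsilon> * m) /
        (Gamma (p - 2 * real s + real k) * Gamma (q + 1 + real (\<upsilon> * m)) * fact k * fact m))"

(* As this is a Lebesgue integral, laplace_transform f a is 0 by convention if it does not
   converge absolutely; laplace_exists records convergence. *)
definition laplace_transform :: "(real \<Rightarrow> complex) \<Rightarrow> complex \<Rightarrow> complex" where
  "laplace_transform f a = (LBINT w=0..\<infinity>. exp (- a * complex_of_real w) * f w)"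

definition laplace_exists :: "(real \<Rightarrow> complex) \<Rightarrow> complex \<Rightarrow> bool" where
  "laplace_exists f a \<longleftrightarrow>
     interval_lebesgue_integrable lborel 0 \<infinity> (\<lambda>w. exp (- a * complex_of_real w) * f w)"

definition hyp1F1 :: "complex \<Rightarrow> complex \<Rightarrow> complex \<Rightarrow> complex" where
  "hyp1F1 \<alpha> c x = (\<Sum>k. pochhammer \<alpha> k / pochhammer c k * (x ^ k / fact k))"

end

theory Submission
  imports Defs
begin

text \<open>
  The polynomial is a finite sum of monomials in \<open>w\<close>, so multiplying by \<open>w powr q\<close> and
  transforming term by term is a matter of one integral: for real \<open>c > 0\<close>,

    \<open>\<integral> exp (- a w) w powr (c - 1) dw = \<Gamma>(c) / a powr c\<close>   over \<open>w > 0\<close>, whenever \<open>Re a > 0\<close>,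

  which is \<open>has_bochner_integral_Gamma_complex_rate\<close>. With \<open>c = q + 1 + \<upsilon> m\<close> its Gamma factor
  cancels the one in the denominator of the coefficient and leaves \<open>z ^ m / a powr (q + 1)\<close> with
  \<open>z = (y / a) ^ \<upsilon>\<close> (\<open>has_bochner_integral_konhauser_N\<close>). In the remaining double sum
  \<open>(-s)\<^sub>k\<^sub>+\<^sub>m = (-s)\<^sub>k (k - s)\<^sub>m\<close>, so the sum over \<open>m\<close> is the binomial expansion
  of \<open>(1 - z) ^ (s - k)\<close>, and the sum over \<open>k\<close> is then the terminating confluent series in
  \<open>1 / (t (1 - z))\<close> (\<open>double_sum_eq_hyp1F1\<close>).

  For real \<open>a\<close> the integral is Euler's integral after rescaling. A complex \<open>a\<close> is reached without
  rotating a contour: the half-plane \<open>Re a > 0\<close> is the union of the discs \<open>\<bar>r - a\<bar> < r\<close> over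
  real \<open>r > 0\<close>. Write \<open>exp (- a w) = exp (- r w) exp ((r - a) w)\<close>, expand the second factor and
  integrate term by term; the resulting series is the binomial series of \<open>(a / r) powr (- c)\<close>.
\<close>

section \<open>The Gamma integral with a complex rate\<close>

lemma Gamma_plus_of_nat_real:
  fixes c :: real
  assumes "c > 0"
  shows "Gamma (c + real n) = Gamma c * pochhammer c n"
proof -
  have "Gamma c \<noteq> 0" using Gamma_real_pos[OF assms] by simp
  moreover have "c \<notin> \<int>\<^sub>\<le>\<^sub>0"
    using assms by (auto elim: nonpos_Ints_cases)
  ultimately show ?thesis by (simp add: pochhammer_Gamma)
qed

lemma has_bochner_integral_Gamma_real:
  fixes c r :: real
  assumes "c > 0" and "r > 0"
  shows "has_bochner_integral lborel
           (\<lambda>w. indicator {0<..} w *\<^sub>R (w powr (c - 1) * exp (- r * w))) (Gamma c / r powr c)"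
proof -
  let ?h = "\<lambda>w::real. indicator {0..} w * w powr (c - 1) / exp w"
  \<comment> \<open>Euler's integral is the case \<open>r = 1\<close>; the rest is the substitution \<open>w \<mapsto> r w\<close>.\<close>
  have "has_bochner_integral lborel ?h (Gamma c)"
  proof (rule has_bochner_integral_nn_integral)
    show "(\<integral>\<^sup>+ x. ennreal (?h x) \<partial>lborel) = ennreal (Gamma c)"
      using Gamma_conv_nn_integral_real[OF assms(1)] by simp
  qed (use assms in \<open>auto intro: less_imp_le Gamma_real_pos\<close>)
  then have "has_bochner_integral lborel (\<lambda>w. ?h (0 + r * w)) (Gamma c /\<^sub>R \<bar>r\<bar>)"
    using lborel_has_bochner_integral_real_affine_iff[of r ?h "Gamma c" 0] assms by simp
  then have "has_bochner_integral lborel (\<lambda>w. r powr (1 - c) * ?h (0 + r * w))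
               (r powr (1 - c) * (Gamma c /\<^sub>R \<bar>r\<bar>))"
    by (rule has_bochner_integral_mult_right)
  moreover have "r powr (1 - c) * ?h (0 + r * w) =
                   indicator {0<..} w *\<^sub>R (w powr (c - 1) * exp (- r * w))" for w
    using assms
    by (cases "w = 0")
       (auto simp: indicator_def zero_le_mult_iff powr_mult exp_minus field_simps powr_diff)
  moreover have "r powr (1 - c) * (Gamma c /\<^sub>R \<bar>r\<bar>) = Gamma c / r powr c"
    using assms by (simp add: powr_diff field_simps)
  ultimately show ?thesis by simp
qed

text \<open>
  The same series is needed at complex \<open>z\<close> to evaluate the integral, at \<open>norm z\<close> to justify
  the termwise integration, and with \<open>c = - of_nat n\<close> for the sum over \<open>m\<close>.
\<close>
lemma negative_binomial_sums:
  fixes c z :: complex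
  assumes "norm z < 1"
  shows "(\<lambda>n. pochhammer c n / fact n * z ^ n) sums (1 - z) powr (- c)"
proof -
  have "(\<lambda>n. ((- c) gchoose n) * (- z) ^ n) sums (1 + (- z)) powr (- c)"
    using assms by (intro gen_binomial_complex) simp
  moreover have "((- c) gchoose n) * (- z) ^ n = pochhammer c n / fact n * z ^ n" for n
    by (simp add: gbinomial_pochhammer power_minus[of z] mult_ac)
  ultimately show ?thesis by simp
qed

lemma finite_negative_binomial:
  fixes z :: complex
  assumes "norm z < 1"
  shows "(\<Sum>m\<le>n. pochhammer (- of_nat n) m / fact m * z ^ m) = (1 - z) ^ n"
proof -
  have "(\<lambda>m. pochhammer (- of_nat n) m / fact m * z ^ m) sums
          (\<Sum>m\<le>n. pochhammer (- of_nat n) m / fact m * z ^ m)"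
    by (rule sums_finite) (auto simp: pochhammer_of_nat_eq_0_lemma)
  moreover have "(1 - z) powr of_nat n = (1 - z) ^ n"
    using assms by (subst powr_nat) auto
  ultimately show ?thesis
    using negative_binomial_sums[OF assms, of "- of_nat n"] by (simp add: sums_iff)
qed

text \<open>
  Integrating \<open>exp ((r - a) w)\<close> term by term against \<open>w powr (c - 1) exp (- r w)\<close> gives
  \<open>\<Gamma>(c) r powr (- c)\<close> times the series \<open>\<Sum>n. (c)\<^sub>n z ^ n / n!\<close> with \<open>z = (r - a) / r\<close>.
  The interchange is legitimate because the integrals of the absolute values give the same series
  at \<open>norm z < 1\<close>. The principal branches match since \<open>a = r (1 - z)\<close> with \<open>r\<close> positive real.
\<close>
lemma has_bochner_integral_Gamma_complex_rate:
  fixes c :: real and a :: complex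
  assumes c: "c > 0" and a: "Re a > 0"
  shows "has_bochner_integral lborel
           (\<lambda>w. indicator {0<..} w *\<^sub>R (exp (- a * of_real w) * of_real (w powr (c - 1))))
           (of_real (Gamma c) / a powr of_real c)"
proof -
  \<comment> \<open>\<open>norm (r - a) < r\<close> amounts to \<open>norm a ^ 2 < 2 r Re a\<close>; this \<open>r\<close> is twice the infimum.\<close>
  define r where "r = (norm a)\<^sup>2 / Re a"
  have r: "r > 0"
  proof -
    have "a \<noteq> 0" using a by auto
    then show ?thesis using a by (simp add: r_def)
  qed
  have near: "norm (of_real r - a) < r"
  proof -
    have "(norm (of_real r - a))\<^sup>2 = r\<^sup>2 - 2 * (r * Re a) + (norm a)\<^sup>2"
      by (simp only: cmod_power2) (simp add: power2_eq_square algebra_simps)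
    also have "r * Re a = (norm a)\<^sup>2"
      using a by (simp add: r_def)
    also have "r\<^sup>2 - 2 * (norm a)\<^sup>2 + (norm a)\<^sup>2 < r\<^sup>2"
      using a by auto
    finally show ?thesis
      using r by (simp add: power2_less_imp_less)
  qed
  define z where "z = (of_real r - a) / of_real r"
  have z: "norm z < 1"
    using near r by (simp add: z_def norm_divide)
  define b where "b = (\<lambda>n w. indicator {0<..} w *\<^sub>R (w powr (c + real n - 1) * exp (- r * w)))"
  define I where "I = (\<lambda>n. Gamma (c + real n) / r powr (c + real n))"
  define f where "f = (\<lambda>n w. (of_real r - a) ^ n / fact n * complex_of_real (b n w))"
  have b: "has_bochner_integral lborel (b n) (I n)" for n
    unfolding b_def I_def using has_bochner_integral_Gamma_real[of "c + real n" r] c r by simp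
  have b_nonneg: "b n w \<ge> 0" for n w
    by (simp add: b_def)
  have I_eq: "I n = Gamma c / r powr c * pochhammer c n / r ^ n" for n
    using c r by (simp add: I_def powr_add powr_realpow Gamma_plus_of_nat_real)
  have f: "has_bochner_integral lborel (f n) ((of_real r - a) ^ n / fact n * of_real (I n))" for n
    unfolding f_def by (intro has_bochner_integral_mult_right has_bochner_integral_of_real b)
  have norm_f: "(\<integral>w. norm (f n w) \<partial>lborel) =
                  Gamma c / r powr c * (pochhammer c n / fact n * norm z ^ n)" for n
  proof -
    have "norm (f n w) = norm (of_real r - a) ^ n / fact n * b n w" for w
      using b_nonneg by (simp add: f_def norm_mult norm_divide norm_power)
    then have "(\<integral>w. norm (f n w) \<partial>lborel) = norm (of_real r - a) ^ n / fact n * I n"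
      using has_bochner_integral_integral_eq[OF b] by simp
    also have "\<dots> = Gamma c / r powr c * (pochhammer c n / fact n * norm z ^ n)"
      using r by (simp add: I_eq z_def norm_divide power_divide mult_ac)
    finally show ?thesis .
  qed
  have pointwise: "(\<lambda>n. f n w) sums
      (indicator {0<..} w *\<^sub>R (exp (- a * of_real w) * of_real (w powr (c - 1))))" for w
  proof (cases "w > 0")
    case True
    have exp_split: "complex_of_real (exp (- r * w)) * exp ((of_real r - a) * of_real w) =
                     exp (- a * of_real w)"
      by (simp add: exp_of_real [symmetric] exp_add [symmetric] algebra_simps del: exp_of_real)
    have "(\<lambda>n. ((of_real r - a) * of_real w) ^ n /\<^sub>R fact n) sums exp ((of_real r - a) * of_real w)"
      by (rule exp_converges)
    then have "(\<lambda>n. of_real (w powr (c - 1) * exp (- r * w)) *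
                 (((of_real r - a) * of_real w) ^ n /\<^sub>R fact n)) sums
               (of_real (w powr (c - 1) * exp (- r * w)) * exp ((of_real r - a) * of_real w))"
      by (rule sums_mult)
    moreover have "of_real (w powr (c - 1) * exp (- r * w)) *
                     (((of_real r - a) * of_real w) ^ n /\<^sub>R fact n) = f n w" for n
      using True
      by (simp add: f_def b_def powr_add powr_diff powr_realpow power_mult_distrib
            scaleR_conv_of_real divide_inverse mult_ac)
    moreover have "of_real (w powr (c - 1) * exp (- r * w)) * exp ((of_real r - a) * of_real w) =
                     of_real (w powr (c - 1)) * exp (- a * of_real w)"
      by (simp only: of_real_mult mult.assoc exp_split)
    ultimately show ?thesis
      using True by (simp only: indicator_simps greaterThan_iff scaleR_one mult.commute)
  qed (simp add: f_def b_def)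
  have summable_norm: "summable (\<lambda>n. norm (f n w))" for w
  proof (cases "w > 0")
    case True
    have "summable (\<lambda>n. w powr (c - 1) * exp (- r * w) *
                 norm (((of_real r - a) * of_real w) ^ n /\<^sub>R fact n))"
      by (intro summable_mult summable_norm_exp)
    moreover have "w powr (c - 1) * exp (- r * w) *
                 norm (((of_real r - a) * of_real w) ^ n /\<^sub>R fact n) = norm (f n w)" for n
      using True
      by (simp add: f_def b_def powr_add powr_diff powr_realpow power_mult_distrib
            norm_mult norm_inverse norm_power divide_inverse mult_ac)
    ultimately show ?thesis by (simp only:)
  qed (simp add: f_def b_def)
  have summable_int: "summable (\<lambda>n. \<integral>w. norm (f n w) \<partial>lborel)"
  proof -
    have "summable (\<lambda>n. pochhammer (of_real c) n / fact n * complex_of_real (norm z) ^ n)"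
      using negative_binomial_sums[of "of_real (norm z)" "of_real c"] z
      by (auto simp: sums_iff)
    then have "summable (\<lambda>n. complex_of_real (pochhammer c n / fact n * norm z ^ n))"
      by (simp add: pochhammer_of_real)
    then have "summable (\<lambda>n. pochhammer c n / fact n * norm z ^ n)"
      by (simp only: summable_of_real_iff)
    then show ?thesis
      unfolding norm_f by (rule summable_mult)
  qed
  have f_int: "integrable lborel (f n)" for n
    using f by (rule integrable.intros)
  note swap = f_int AE_I2[OF summable_norm] summable_int
  have limit: "(\<lambda>w. \<Sum>n. f n w) =
      (\<lambda>w. indicator {0<..} w *\<^sub>R (exp (- a * of_real w) * of_real (w powr (c - 1))))"
    using pointwise by (simp add: sums_iff)
  have value_series: "(\<lambda>n. integral\<^sup>L lborel (f n)) sums (of_real (Gamma c) / a powr of_real c)"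
  proof -
    have "(\<lambda>n. of_real (Gamma c / r powr c) * (pochhammer (of_real c) n / fact n * z ^ n)) sums
            (of_real (Gamma c / r powr c) * (1 - z) powr (- of_real c))"
      by (intro sums_mult negative_binomial_sums z)
    moreover have "of_real (Gamma c / r powr c) * (pochhammer (of_real c) n / fact n * z ^ n) =
                     integral\<^sup>L lborel (f n)" for n
      using r by (simp add: has_bochner_integral_integral_eq[OF f] I_eq z_def power_divide
            pochhammer_of_real field_simps)
    moreover have "of_real (Gamma c / r powr c) * (1 - z) powr (- of_real c) =
                     of_real (Gamma c) / a powr of_real c"
    proof -
      have "a = of_real r * (1 - z)"
        using r by (simp add: z_def field_simps)
      then have "a powr of_real c = of_real r powr of_real c * (1 - z) powr of_real c"
        using r powr_times_real_left[of "of_real r" "1 - z" "of_real c"] by simp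
      also have "of_real r powr of_real c = complex_of_real (r powr c)"
        using r by (simp add: powr_of_real)
      finally show ?thesis
        by (simp add: powr_minus field_simps)
    qed
    ultimately show ?thesis by simp
  qed
  show ?thesis
    unfolding has_bochner_integral_iff limit [symmetric]
    using integrable_suminf[OF swap] sums_unique2[OF sums_integral[OF swap] value_series] by simp
qed

section \<open>Transforming the polynomial\<close>

text \<open>
  Stated as a Bochner integral over the half-line, so that one statement yields both the
  convergence and the value of the transform.
\<close>
lemma has_bochner_integral_konhauser_N:
  fixes \<upsilon> s :: nat and p q t y :: real and a :: complex
  assumes q: "q > -1" and a: "Re a > 0"
  shows "has_bochner_integral lborel
    (\<lambda>w. indicator {0<..} w *\<^sub>R
       (exp (- a * of_real w) * complex_of_real (w powr q * konhauser_N s \<upsilon> p q t (y * w))))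
    (of_real (Gamma (p - real s)) * (\<Sum>k\<le>s. \<Sum>m\<le>s - k.
       pochhammer (- of_nat s) (k + m) * of_real t ^ (s - k) * (of_real y ^ \<upsilon> / a ^ \<upsilon>) ^ m /
       (of_real (Gamma (p - 2 * real s + real k)) * fact k * fact m)) / a powr of_real (q + 1))"
proof -
  define C where "C = (\<lambda>k m. pochhammer (- real s) (k + m) * t ^ (s - k) * y ^ (\<upsilon> * m) /
        (Gamma (p - 2 * real s + real k) * Gamma (q + 1 + real (\<upsilon> * m)) * fact k * fact m))"
  define E where "E = (\<lambda>m w. indicator {0<..} w *\<^sub>R
       (exp (- a * of_real w) * complex_of_real (w powr (q + 1 + real (\<upsilon> * m) - 1))))"
  have integral: "has_bochner_integral lborel
     (\<lambda>w. of_real (Gamma (p - real s)) *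
            (\<Sum>k\<le>s. \<Sum>m\<le>s - k. of_real (C k m) * E m w))
     (of_real (Gamma (p - real s)) * (\<Sum>k\<le>s. \<Sum>m\<le>s - k. of_real (C k m) *
        (of_real (Gamma (q + 1 + real (\<upsilon> * m))) / a powr of_real (q + 1 + real (\<upsilon> * m)))))"
    unfolding E_def using q a
    by (intro has_bochner_integral_mult_right has_bochner_integral_sum
          has_bochner_integral_Gamma_complex_rate) (auto intro: add_pos_nonneg)
  have integrand: "of_real (Gamma (p - real s)) *
            (\<Sum>k\<le>s. \<Sum>m\<le>s - k. of_real (C k m) * E m w) =
       indicator {0<..} w *\<^sub>R
       (exp (- a * of_real w) * complex_of_real (w powr q * konhauser_N s \<upsilon> p q t (y * w)))" for w
  proof (cases "w > 0")
    case True
    then have "E m w = exp (- a * of_real w) * of_real (w powr q) * of_real (w ^ (\<upsilon> * m))" for m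
      using powr_realpow[of w "\<upsilon> * m"] by (simp add: E_def powr_add)
    then show ?thesis
      using True
      by (simp add: konhauser_N_def C_def sum_distrib_left atMost_atLeast0 power_mult_distrib mult_ac)
  qed (simp add: E_def)
  have coefficient: "of_real (C k m) *
        (of_real (Gamma (q + 1 + real (\<upsilon> * m))) / a powr of_real (q + 1 + real (\<upsilon> * m))) =
       pochhammer (- of_nat s) (k + m) * of_real t ^ (s - k) * (of_real y ^ \<upsilon> / a ^ \<upsilon>) ^ m /
       (of_real (Gamma (p - 2 * real s + real k)) * fact k * fact m) / a powr of_real (q + 1)" for k m
  proof -
    have "a \<noteq> 0" using a by auto
    then have pw: "a powr of_real (q + 1 + real (\<upsilon> * m)) = a powr of_real (q + 1) * (a ^ \<upsilon>) ^ m"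
      by (simp add: powr_add powr_nat power_mult flip: of_nat_mult)
    have "Gamma (q + 1 + real (\<upsilon> * m)) > 0"
      using q by (intro Gamma_real_pos) (auto intro: add_pos_nonneg)
    moreover have "complex_of_real (pochhammer (- real s) (k + m)) = pochhammer (- of_nat s) (k + m)"
      by (simp flip: pochhammer_of_real)
    ultimately show ?thesis
      unfolding pw C_def by (simp add: power_mult power_divide mult_ac del: of_nat_mult)
  qed
  show ?thesis
    using integral unfolding integrand coefficient
    by (simp only: sum_divide_distrib flip: times_divide_eq_right)
qed

text \<open>
  After the inner sum is evaluated, \<open>(t (1 - z)) ^ (s - k)\<close> splits into a common factor
  \<open>(t (1 - z)) ^ s\<close> and the \<open>k\<close>-th power of the argument of the confluent series, while
  \<open>\<Gamma>(b + k) = \<Gamma>(b) (b)\<^sub>k\<close> supplies its denominators.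
\<close>
lemma double_sum_eq_hyp1F1:
  fixes t z :: complex and b :: real
  assumes b: "b > 0" and t: "t \<noteq> 0" and z: "norm z < 1"
  shows "(\<Sum>k\<le>s. \<Sum>m\<le>s - k. pochhammer (- of_nat s) (k + m) * t ^ (s - k) * z ^ m /
            (of_real (Gamma (b + real k)) * fact k * fact m)) =
         (t * (1 - z)) ^ s * hyp1F1 (- of_nat s) (of_real b) (1 / (t * (1 - z))) / of_real (Gamma b)"
proof -
  let ?x = "t * (1 - z)"
  have x: "?x \<noteq> 0" using t z by auto
  have inner: "(\<Sum>m\<le>s - k. pochhammer (- of_nat s) (k + m) * t ^ (s - k) * z ^ m /
            (of_real (Gamma (b + real k)) * fact k * fact m)) =
      ?x ^ s * (pochhammer (- of_nat s) k / pochhammer (of_real b) k * ((1 / ?x) ^ k / fact k)) /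
        of_real (Gamma b)" if k: "k \<le> s" for k
  proof -
    have gamma: "of_real (Gamma (b + real k)) = of_real (Gamma b) * pochhammer (complex_of_real b) k"
      using b by (simp add: Gamma_plus_of_nat_real flip: pochhammer_of_real)
    have "(\<Sum>m\<le>s - k. pochhammer (- of_nat s) (k + m) * t ^ (s - k) * z ^ m /
            (of_real (Gamma (b + real k)) * fact k * fact m)) =
          pochhammer (- of_nat s) k * t ^ (s - k) / (of_real (Gamma (b + real k)) * fact k) *
          (\<Sum>m\<le>s - k. pochhammer (- of_nat (s - k)) m / fact m * z ^ m)"
      using k by (simp add: sum_distrib_left sum_divide_distrib pochhammer_product' of_nat_diff mult_ac)
    also have "\<dots> = pochhammer (- of_nat s) k * ?x ^ (s - k) /
                     (of_real (Gamma (b + real k)) * fact k)"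
      using finite_negative_binomial[OF z, of "s - k"] by (simp add: power_mult_distrib)
    also have "?x ^ (s - k) = ?x ^ s * (1 / ?x) ^ k"
      using x k by (simp add: power_diff power_one_over)
    finally show ?thesis by (simp add: gamma mult_ac)
  qed
  have "hyp1F1 (- of_nat s) (of_real b) (1 / ?x) =
     (\<Sum>k\<le>s. pochhammer (- of_nat s) k / pochhammer (of_real b) k * ((1 / ?x) ^ k / fact k))"
    unfolding hyp1F1_def by (rule suminf_finite) (auto simp: pochhammer_of_nat_eq_0_lemma)
  then show ?thesis
    by (simp add: inner sum_distrib_left sum_divide_distrib)
qed

theorem theorem30:
  fixes \<upsilon> s :: nat and p q t y :: real and a :: complex
  assumes "\<upsilon> \<ge> 1"
    and "q > -1"
    and "real s < (p - 1) / 2"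
    and "t \<noteq> 0"
    and "Re a > 0"
    and "norm (complex_of_real y ^ \<upsilon> / a ^ \<upsilon>) < 1"
  shows "laplace_exists (\<lambda>w. complex_of_real (w powr q * konhauser_N s \<upsilon> p q t (y * w))) a \<and>
    laplace_transform (\<lambda>w. complex_of_real (w powr q * konhauser_N s \<upsilon> p q t (y * w))) a =
      complex_of_real (Gamma (p - real s)) /
        (a powr complex_of_real (q + 1) * complex_of_real (Gamma (p - 2 * real s))) *
      (complex_of_real t * (a ^ \<upsilon> - complex_of_real y ^ \<upsilon>) / a ^ \<upsilon>) ^ s *
      hyp1F1 (- of_nat s) (complex_of_real (p - 2 * real s))
        (a ^ \<upsilon> / (complex_of_real t * (a ^ \<upsilon> - complex_of_real y ^ \<upsilon>)))"
proof -
  let ?z = "complex_of_real y ^ \<upsilon> / a ^ \<upsilon>"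
  let ?F = "\<lambda>w. complex_of_real (w powr q * konhauser_N s \<upsilon> p q t (y * w))"
  have "a \<noteq> 0" using assms(5) by auto
  then have x: "of_real t * (a ^ \<upsilon> - of_real y ^ \<upsilon>) / a ^ \<upsilon> = of_real t * (1 - ?z)"
      "a ^ \<upsilon> / (of_real t * (a ^ \<upsilon> - of_real y ^ \<upsilon>)) = 1 / (of_real t * (1 - ?z))"
    by (simp_all add: diff_divide_distrib right_diff_distrib flip: mult.assoc)
       (simp_all add: field_simps)
  note int = has_bochner_integral_konhauser_N[OF assms(2,5), of s \<upsilon> p t y]
  have "laplace_exists ?F a"
    unfolding laplace_exists_def zero_ereal_def interval_integrable_to_infinity_eq set_integrable_def
    using int by (simp add: has_bochner_integral_iff)
  moreover have "laplace_transform ?F a = of_real (Gamma (p - real s)) * (\<Sum>k\<le>s. \<Sum>m\<le>s - k.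
       pochhammer (- of_nat s) (k + m) * of_real t ^ (s - k) * ?z ^ m /
       (of_real (Gamma (p - 2 * real s + real k)) * fact k * fact m)) / a powr of_real (q + 1)"
    unfolding laplace_transform_def zero_ereal_def interval_integral_to_infinity_eq
      set_lebesgue_integral_def
    using int by (simp only: has_bochner_integral_iff)
  moreover have "p - 2 * real s > 0"
    using assms(3) by simp
  ultimately show ?thesis
    unfolding x using double_sum_eq_hyp1F1[of "p - 2 * real s" "of_real t" ?z s] assms(4,6)
    by (simp add: mult_ac)
qed

end
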